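(* Let $X$ and $Y$ be Hausdorff locally convex spaces, let $X$ be C-sequential, and let $\mathcal S$ be a set of linear maps from $X$ to $Y$. Then the following assertions are equivalent. (a) $\mathcal S$ is sequentially equicontinuous. (b) $\mathcal S$ is equicontinuous.
   Context: For a Hausdorff locally convex space $X$, $\mathcal P_X$ denotes a directed system of seminorms generating its topology. A set $\mathcal S$ of linear maps $X\to Y$ is equicontinuous if for all $p\in\mathcal P_Y$ there are $q\in\mathcal P_X$ and $K\ge0$ with $\sup_{T\in\mathcal S}p(Tx)\le Kq(x)$ for all $x\in X$. It is sequentially equicontinuous if for all $p\in\mathcal P_Y$ and all sequences $(x_n)$ in $X$ with $x_n\to0$ one has $\sup_{T\in\mathcal S}p(Tx_n)\to0$. A subset $U$ of a topological space is sequentially open if every sequence converging to a point of $U$ is eventually in $U$. A Hausdorff locally convex space is C-sequential if every convex sequentially open subset is open. *)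

theory Defs
  imports Complex_Main "HOL-Library.Extended_Nonnegative_Real"
begin

text \<open>
  The scalar field is a type of class \<open>real_normed_field\<close>. By the Gelfand--Mazur theorem such a
  field is isomorphic to the reals or the complex numbers, so this covers real and complex
  spaces uniformly; real scalars are embedded via \<open>of_real\<close>.
\<close>

definition seminorm ::
  "('k::real_normed_field \<Rightarrow> 'a::ab_group_add \<Rightarrow> 'a) \<Rightarrow> ('a \<Rightarrow> real) \<Rightarrow> bool" where
  "seminorm scale p \<longleftrightarrow>
     (\<forall>x. 0 \<le> p x) \<and>
     (\<forall>x y. p (x + y) \<le> p x + p y) \<and>
     (\<forall>c x. p (scale c x) = norm c * p x)"

text \<open>
  The Hausdorff topology is that of the class \<open>t2_space\<close>; \<open>P\<close> is a directed system of seminorms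
  generating it, i.e. the open seminorm balls form a subbasis.
\<close>

locale hausdorff_lcs = vector_space scale
  for scale :: "'k::real_normed_field \<Rightarrow> 'a::{ab_group_add,t2_space} \<Rightarrow> 'a" +
  fixes P :: "('a \<Rightarrow> real) set"
  assumes seminorms: "p \<in> P \<Longrightarrow> seminorm scale p"
    and nonempty: "P \<noteq> {}"
    and directed: "p \<in> P \<Longrightarrow> q \<in> P \<Longrightarrow> \<exists>r\<in>P. p \<le> r \<and> q \<le> r"
    and generates: "open = generate_topology {{y. p (y - x) < e} | p x e. p \<in> P \<and> 0 < e}"

definition convex_set ::
  "('k::real_normed_field \<Rightarrow> 'a::ab_group_add \<Rightarrow> 'a) \<Rightarrow> 'a set \<Rightarrow> bool" where
  "convex_set scale A \<longleftrightarrow>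
     (\<forall>x\<in>A. \<forall>y\<in>A. \<forall>t::real. 0 \<le> t \<and> t \<le> 1 \<longrightarrow>
        scale (of_real (1 - t)) x + scale (of_real t) y \<in> A)"

definition sequentially_open :: "'a::topological_space set \<Rightarrow> bool" where
  "sequentially_open U \<longleftrightarrow>
     (\<forall>x\<in>U. \<forall>xs. xs \<longlonglongrightarrow> x \<longrightarrow> (\<forall>\<^sub>F n in sequentially. xs n \<in> U))"

definition C_sequential ::
  "('k::real_normed_field \<Rightarrow> 'a::{ab_group_add,topological_space} \<Rightarrow> 'a) \<Rightarrow> bool" where
  "C_sequential scale \<longleftrightarrow>
     (\<forall>U::'a set. convex_set scale U \<and> sequentially_open U \<longrightarrow> open U)"

text \<open>
  Suprema are taken in \<open>[0, \<infinity>]\<close>: they may be infinite, and the supremum over the empty set is 0.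
\<close>

definition equicontinuous ::
  "('a \<Rightarrow> real) set \<Rightarrow> ('b \<Rightarrow> real) set \<Rightarrow> ('a \<Rightarrow> 'b) set \<Rightarrow> bool" where
  "equicontinuous PX PY S \<longleftrightarrow>
     (\<forall>p\<in>PY. \<exists>q\<in>PX. \<exists>K\<ge>0. \<forall>x. (SUP T\<in>S. ennreal (p (T x))) \<le> ennreal (K * q x))"

definition sequentially_equicontinuous ::
  "('b \<Rightarrow> real) set \<Rightarrow> ('a::{zero,topological_space} \<Rightarrow> 'b) set \<Rightarrow> bool" where
  "sequentially_equicontinuous PY S \<longleftrightarrow>
     (\<forall>p\<in>PY. \<forall>xs. xs \<longlonglongrightarrow> 0 \<longrightarrow> (\<lambda>n. SUP T\<in>S. ennreal (p (T (xs n)))) \<longlonglongrightarrow> 0)"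

end

theory Submission
  imports Defs
begin

text \<open>
  If \<open>\<S>\<close> is sequentially equicontinuous and \<open>p\<close> is a seminorm on \<open>Y\<close>, then the set of
  all \<open>x\<close> with \<open>sup\<^sub>T p (T x) < 1\<close> is convex and sequentially open, hence open because
  \<open>X\<close> is C-sequential. So it contains a ball of some \<open>q \<in> \<P>\<^sub>X\<close> around \<open>0\<close>, and homogeneity
  turns this inclusion into the required estimate.
\<close>

lemma seminorm_zero:
  assumes "vector_space scale" and "seminorm scale p"
  shows "p 0 = 0"
proof -
  interpret vector_space scale by fact
  have "p (scale 0 0) = norm (0::'a) * p 0"
    using assms(2) unfolding seminorm_def by blast
  then show ?thesis by simp
qed

context hausdorff_lcs
begin

text \<open>The balls are only given as a subbasis. Directedness makes balls of a single seminorm a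
  neighbourhood base: a common upper bound of two seminorms handles finite intersections.\<close>

lemma seminorm_ball_in_open:
  assumes "open U" and "x \<in> U"
  obtains q e where "q \<in> P" and "0 < e" and "{y. q (y - x) < e} \<subseteq> U"
proof -
  have "generate_topology {{y. p (y - x) < e} | p x e. p \<in> P \<and> 0 < e} U"
    using assms(1) by (simp add: generates)
  then have "x \<in> U \<Longrightarrow> \<exists>q\<in>P. \<exists>e>0. {y. q (y - x) < e} \<subseteq> U"
  proof (induction)
    case UNIV
    have "\<exists>q. q \<in> P" using nonempty by blast
    then show ?case using zero_less_one by blast
  next
    case (Int a b)
    then obtain q e q' e' where *: "q \<in> P" "0 < e" "{y. q (y - x) < e} \<subseteq> a"
      "q' \<in> P" "0 < e'" "{y. q' (y - x) < e'} \<subseteq> b"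
      by blast
    obtain r where r: "r \<in> P" "q \<le> r" "q' \<le> r"
      using directed[OF *(1,4)] by blast
    have "{y. r (y - x) < min e e'} \<subseteq> a \<inter> b"
    proof
      fix y assume "y \<in> {y. r (y - x) < min e e'}"
      moreover have "q (y - x) \<le> r (y - x)" "q' (y - x) \<le> r (y - x)"
        using r by (auto simp: le_fun_def)
      ultimately have "q (y - x) < e" "q' (y - x) < e'"
        by auto
      then show "y \<in> a \<inter> b" using * by blast
    qed
    then show ?case using r(1) *(2,5) by (metis min_less_iff_conj)
  next
    case (UN K)
    then show ?case by (meson Union_iff Union_upper subset_trans)
  next
    case (Basis s)
    then obtain p z e where s: "p \<in> P" "s = {y. p (y - z) < e}"
      by blast
    \<comment> \<open>The basic ball is centred at \<open>z\<close>, not at \<open>x\<close>. By the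
      triangle inequality the remaining radius \<open>e - p (x - z)\<close> works around
      \<open>x\<close>.\<close>
    have "p (y - z) \<le> p (y - x) + p (x - z)" for y
      using seminorms[OF s(1)] unfolding seminorm_def by (metis diff_add_cancel diff_add_eq add_diff_eq)
    then have "{y. p (y - x) < e - p (x - z)} \<subseteq> s"
      unfolding s(2) by (smt (verit) Collect_mono)
    moreover have "0 < e - p (x - z)" using Basis s by simp
    ultimately show ?case using s(1) by blast
  qed
  then show ?thesis using assms(2) that by blast
qed

text \<open>Forward, each ball around \<open>x\<close> is a generating open set; backward, every
  neighbourhood of \<open>x\<close> contains a ball. Since only \<open>xs n - x\<close> enters the
  right-hand side, this yields translation invariance of convergence, which the class
  \<open>t2_space\<close> does not provide.\<close>

lemma tendsto_iff_seminorms: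
  "(f \<longlongrightarrow> x) F \<longleftrightarrow> (\<forall>p\<in>P. ((\<lambda>n. p (f n - x)) \<longlongrightarrow> 0) F)"
proof
  assume f: "(f \<longlongrightarrow> x) F"
  show "\<forall>p\<in>P. ((\<lambda>n. p (f n - x)) \<longlongrightarrow> 0) F"
  proof
    fix p assume p: "p \<in> P"
    note sp = seminorms[OF p]
    have p0: "p 0 = 0" using seminorm_zero[OF vector_space_axioms sp] .
    have "\<forall>\<^sub>F n in F. p (f n - x) < e" if "0 < e" for e
    proof -
      have "open {y. p (y - x) < e}"
        unfolding generates using p that by (intro generate_topology.Basis) blast
      then have "\<forall>\<^sub>F n in F. f n \<in> {y. p (y - x) < e}"
        by (rule topological_tendstoD[OF f]) (simp add: p0 that)
      then show ?thesis by simp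
    qed
    moreover have "0 \<le> p y" for y
      using sp by (simp add: seminorm_def)
    ultimately show "((\<lambda>n. p (f n - x)) \<longlongrightarrow> 0) F"
      unfolding tendsto_iff by simp
  qed
next
  assume f: "\<forall>p\<in>P. ((\<lambda>n. p (f n - x)) \<longlongrightarrow> 0) F"
  show "(f \<longlongrightarrow> x) F"
  proof (rule topological_tendstoI)
    fix U assume "open U" "x \<in> U"
    then obtain q e where q: "q \<in> P" "0 < e" "{y. q (y - x) < e} \<subseteq> U"
      by (rule seminorm_ball_in_open)
    have "\<forall>\<^sub>F n in F. q (f n - x) < e"
      by (rule order_tendstoD(2)[OF bspec[OF f q(1)] q(2)])
    then show "\<forall>\<^sub>F n in F. f n \<in> U"
      by (rule eventually_mono) (use q(3) in blast)
  qed
qed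

end

text \<open>Trades the supremum in the extended reals for a real bound valid for all
  \<open>T\<close> at once, the form in which the triangle inequality can be applied.\<close>

lemma sequentially_equicontinuousD:
  assumes "sequentially_equicontinuous PY S" and "p \<in> PY" and "xs \<longlonglongrightarrow> 0" and "0 < e"
  shows "\<forall>\<^sub>F n in sequentially. \<forall>T\<in>S. p (T (xs n)) \<le> e"
proof -
  have "(\<lambda>n. SUP T\<in>S. ennreal (p (T (xs n)))) \<longlonglongrightarrow> 0"
    using assms(1-3) unfolding sequentially_equicontinuous_def by blast
  then have "\<forall>\<^sub>F n in sequentially. (SUP T\<in>S. ennreal (p (T (xs n)))) < ennreal e"
    by (rule order_tendstoD) (simp add: assms(4))
  then show ?thesis
  proof (rule eventually_mono)
    fix n assume *: "(SUP T\<in>S. ennreal (p (T (xs n)))) < ennreal e"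
    show "\<forall>T\<in>S. p (T (xs n)) \<le> e"
    proof
      fix T assume "T \<in> S"
      then have "ennreal (p (T (xs n))) \<le> (SUP T\<in>S. ennreal (p (T (xs n))))"
        by (rule SUP_upper)
      also have "\<dots> \<le> ennreal e"
        using * by (rule less_imp_le)
      finally show "p (T (xs n)) \<le> e" using assms(4) by (simp add: ennreal_le_iff)
    qed
  qed
qed

text \<open>The supremum is squeezed between \<open>0\<close> and \<open>K * q (xs n)\<close>, and
  the latter tends to \<open>0\<close> with \<open>xs\<close>.\<close>

lemma equicontinuous_imp_sequentially_equicontinuous:
  fixes S :: "('x::{ab_group_add,t2_space} \<Rightarrow> 'y) set"
  assumes "hausdorff_lcs scale PX" and "equicontinuous PX PY S"
  shows "sequentially_equicontinuous PY S"
  unfolding sequentially_equicontinuous_def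
proof (intro ballI allI impI)
  interpret hausdorff_lcs scale PX by fact
  fix p and xs :: "nat \<Rightarrow> 'x"
  assume p: "p \<in> PY" and xs: "xs \<longlonglongrightarrow> 0"
  obtain q K where q: "q \<in> PX"
    and *: "\<And>x. (SUP T\<in>S. ennreal (p (T x))) \<le> ennreal (K * q x)"
    using assms(2) p unfolding equicontinuous_def by blast
  have "(\<lambda>n. q (xs n)) \<longlonglongrightarrow> 0"
    using bspec[OF iffD1[OF tendsto_iff_seminorms xs] q] by simp
  then have "(\<lambda>n. ennreal (K * q (xs n))) \<longlonglongrightarrow> ennreal (K * 0)"
    by (rule tendsto_ennrealI[OF tendsto_mult_left])
  then have "(\<lambda>n. ennreal (K * q (xs n))) \<longlonglongrightarrow> 0"
    by simp
  then show "(\<lambda>n. SUP T\<in>S. ennreal (p (T (xs n)))) \<longlonglongrightarrow> 0"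
    by (rule tendsto_sandwich[OF _ _ tendsto_const, rotated 2]) (auto simp: *)
qed

lemma sequentially_equicontinuous_imp_equicontinuous:
  assumes "hausdorff_lcs scaleX PX" and "hausdorff_lcs scaleY PY"
    and "C_sequential scaleX"
    and lin: "\<forall>T\<in>S. Vector_Spaces.linear scaleX scaleY T"
    and seq: "sequentially_equicontinuous PY S"
  shows "equicontinuous PX PY S"
  unfolding equicontinuous_def
proof
  interpret X: hausdorff_lcs scaleX PX by fact
  interpret Y: hausdorff_lcs scaleY PY by fact
  fix p assume p: "p \<in> PY"
  have p_nonneg: "0 \<le> p y" and p_add: "p (y + z) \<le> p y + p z"
    and p_scale: "p (scaleY c y) = norm c * p y" for y z c
    using Y.seminorms[OF p] unfolding seminorm_def by auto
  have T_add: "T (x + y) = T x + T y" and T_scale: "T (scaleX c x) = scaleY c (T x)"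
    if "T \<in> S" for T x y c
    using lin that by (auto simp: Vector_Spaces.linear_iff)
  have p_T_zero: "p (T 0) = 0" if "T \<in> S" for T
    using T_scale[OF that, of 0 0] p_scale[of 0] by simp
  \<comment> \<open>This is the condition that the supremum be below \<open>1\<close>, in real
    terms. The bound \<open>c\<close> is shared by all \<open>T\<close>; its distance to
    \<open>1\<close> is the margin used for sequential openness. For empty \<open>S\<close> the set
    is the whole space.\<close>
  define U where "U = {x. \<exists>c<1. \<forall>T\<in>S. p (T x) \<le> c}"
  have "convex_set scaleX U"
    unfolding convex_set_def
  proof (intro ballI allI impI)
    fix x y and t :: real
    assume "x \<in> U" "y \<in> U" and t: "0 \<le> t \<and> t \<le> 1"
    then obtain c d where c: "c < 1" "\<And>T. T \<in> S \<Longrightarrow> p (T x) \<le> c"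
      and d: "d < 1" "\<And>T. T \<in> S \<Longrightarrow> p (T y) \<le> d"
      unfolding U_def by blast
    have "(1 - t) * c + t * d < 1"
      using convex_bound_lt[OF c(1) d(1), of "1 - t" t] t by simp
    moreover have "p (T (scaleX (of_real (1 - t)) x + scaleX (of_real t) y)) \<le> (1 - t) * c + t * d"
      if "T \<in> S" for T
    proof -
      have "p (T (scaleX (of_real (1 - t)) x + scaleX (of_real t) y))
          \<le> p (scaleY (of_real (1 - t)) (T x)) + p (scaleY (of_real t) (T y))"
        using p_add that by (simp add: T_add T_scale)
      also have "\<dots> = (1 - t) * p (T x) + t * p (T y)"
        using t unfolding p_scale norm_of_real by simp
      also have "\<dots> \<le> (1 - t) * c + t * d"
        using t c(2) d(2) that by (intro add_mono mult_left_mono) auto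
      finally show ?thesis .
    qed
    ultimately show "scaleX (of_real (1 - t)) x + scaleX (of_real t) y \<in> U"
      unfolding U_def by blast
  qed
  moreover have "sequentially_open U"
    unfolding sequentially_open_def
  proof (intro ballI allI impI)
    fix x xs assume "x \<in> U" and xs: "xs \<longlonglongrightarrow> x"
    then obtain c where c: "c < 1" "\<And>T. T \<in> S \<Longrightarrow> p (T x) \<le> c"
      unfolding U_def by blast
    \<comment> \<open>Sequential equicontinuity speaks of null sequences only, so the sequence is
      shifted to \<open>0\<close>; linearity of \<open>T\<close> shifts back.\<close>
    have "(\<lambda>n. xs n - x) \<longlonglongrightarrow> 0"
      using xs by (simp add: X.tendsto_iff_seminorms)
    \<comment> \<open>Half of the margin \<open>1 - c\<close> is spent, so that \<open>xs n\<close>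
      obeys the uniform bound \<open>(1 + c) / 2\<close>, still below \<open>1\<close>.\<close>
    then have "\<forall>\<^sub>F n in sequentially. \<forall>T\<in>S. p (T (xs n - x)) \<le> (1 - c) / 2"
      using c(1) by (intro sequentially_equicontinuousD[OF seq p]) auto
    then show "\<forall>\<^sub>F n in sequentially. xs n \<in> U"
    proof (rule eventually_mono)
      fix n assume *: "\<forall>T\<in>S. p (T (xs n - x)) \<le> (1 - c) / 2"
      have "p (T (xs n)) \<le> (1 - c) / 2 + c" if "T \<in> S" for T
      proof -
        have "p (T (xs n)) \<le> p (T (xs n - x)) + p (T x)"
          using p_add T_add[OF that, of "xs n - x" x] by simp
        also have "\<dots> \<le> (1 - c) / 2 + c"
          using * c(2) that by (intro add_mono) auto
        finally show ?thesis .
      qed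
      moreover have "(1 - c) / 2 + c < 1" using c(1) by (simp add: field_simps)
      ultimately show "xs n \<in> U" unfolding U_def by blast
    qed
  qed
  ultimately have "open U"
    using assms(3) unfolding C_sequential_def by blast
  moreover have "0 \<in> U"
    unfolding U_def using p_T_zero by (auto intro!: exI[of _ 0])
  ultimately obtain q e where q: "q \<in> PX" "0 < e" and "{y. q (y - 0) < e} \<subseteq> U"
    by (rule X.seminorm_ball_in_open)
  then have ball: "p (T y) \<le> 1" if "q y < e" "T \<in> S" for y T
    using that unfolding U_def by fastforce
  have q_nonneg: "0 \<le> q x" and q_scale: "q (scaleX c x) = norm c * q x" for x c
    using X.seminorms[OF q(1)] unfolding seminorm_def by auto
  \<comment> \<open>The slack \<open>d\<close> avoids dividing by \<open>q x\<close>, which may be \<open>0\<close>.\<close>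
  have "p (T x) \<le> 1 / e * q x" if T: "T \<in> S" for T x
  proof (rule field_le_epsilon)
    fix d :: real assume d: "0 < d"
    define s where "s = q x / e + d"
    have s: "0 < s" "q x < s * e"
      using d q(2) q_nonneg[of x] by (auto simp: s_def field_simps intro: add_nonneg_pos)
    \<comment> \<open>Dividing by \<open>s\<close> moves \<open>x\<close> into the ball on which
      each \<open>p (T y)\<close> is at most \<open>1\<close>; homogeneity of \<open>p\<close> then
      gives \<open>p (T x) \<le> s\<close>.\<close>
    have "q (scaleX (of_real (inverse s)) x) < e"
      using s unfolding q_scale norm_of_real by (simp add: field_simps)
    then have "p (T (scaleX (of_real (inverse s)) x)) \<le> 1"
      using ball T by blast
    then have "p (T x) \<le> s"
      using s unfolding T_scale[OF T] p_scale norm_of_real by (simp add: field_simps)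
    then show "p (T x) \<le> 1 / e * q x + d" by (simp add: s_def)
  qed
  \<comment> \<open>The constant \<open>1 / e\<close> and the seminorm \<open>q\<close> come from
    the ball inside \<open>U\<close> and do not depend on \<open>T\<close>, so the estimate passes
    to the supremum.\<close>
  then have "\<forall>x. (SUP T\<in>S. ennreal (p (T x))) \<le> ennreal (1 / e * q x)"
    by (intro allI SUP_least ennreal_leI)
  then show "\<exists>q\<in>PX. \<exists>K\<ge>0. \<forall>x. (SUP T\<in>S. ennreal (p (T x))) \<le> ennreal (K * q x)"
    using q by (intro bexI[of _ q] exI[of _ "1 / e"]) auto
qed

theorem theorem2p3:
  fixes scaleX :: "'k::real_normed_field \<Rightarrow> 'x::{ab_group_add,t2_space} \<Rightarrow> 'x"
    and scaleY :: "'k \<Rightarrow> 'y::{ab_group_add,t2_space} \<Rightarrow> 'y"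
    and PX :: "('x \<Rightarrow> real) set"
    and PY :: "('y \<Rightarrow> real) set"
    and S :: "('x \<Rightarrow> 'y) set"
  assumes "hausdorff_lcs scaleX PX"
    and "hausdorff_lcs scaleY PY"
    and "C_sequential scaleX"
    and "\<forall>T\<in>S. Vector_Spaces.linear scaleX scaleY T"
  shows "sequentially_equicontinuous PY S \<longleftrightarrow> equicontinuous PX PY S"
  using equicontinuous_imp_sequentially_equicontinuous[OF assms(1)]
    sequentially_equicontinuous_imp_equicontinuous[OF assms] by blast

end
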